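(* Let $(P,\rho)$ be a weakly ranked locally finite poset, $\kappa$ a $(P,\rho)$-kernel with right KLS function $f$, left KLS function $g$, and Chow function $\mathrm{H}$. Then for all $s<t$ in $P$, $$\mathrm{H}_{st}(x)=\frac{f^{\mathrm{rev}}_{st}(x)-f_{st}(x)}{x-1}+\sum_{s<w<t}\mathrm{H}_{sw}(x)\,\frac{f^{\mathrm{rev}}_{wt}(x)-xf_{wt}(x)}{x-1},$$ $$\mathrm{H}_{st}(x)=\frac{g^{\mathrm{rev}}_{st}(x)-g_{st}(x)}{x-1}+\sum_{s<w<t}\frac{g^{\mathrm{rev}}_{sw}(x)-xg_{sw}(x)}{x-1}\,\mathrm{H}_{wt}(x).$$
   Context: $P$ is a locally finite poset; $\operatorname{Int}(P)$ is its set of closed intervals. A weak rank function is a map $\rho:\operatorname{Int}(P)\to\mathbb{Z}_{\ge0}$, $[s,t]\mapsto\rho_{st}$, with $\rho_{st}>0$ whenever $s<t$ and $\rho_{st}=\rho_{sw}+\rho_{wt}$ for $s\le w\le t$. The incidence algebra $\mathcal{I}(P)$ consists of maps $a$ assigning to each $[s,t]$ a polynomial $a_{st}(x)\in\mathbb{Z}[x]$, with product $(ab)_{st}=\sum_{s\le w\le t}a_{sw}b_{wt}$. $\mathcal{I}_\rho(P)=\{a:\deg a_{st}\le\rho_{st}\}$, and $a^{\mathrm{rev}}_{st}(x)=x^{\rho_{st}}a_{st}(x^{-1})$. A $(P,\rho)$-kernel is $\kappa\in\mathcal{I}_\rho(P)$ with $\kappa_{ss}=1$ for all $s$ and $\kappa^{-1}=\kappa^{\mathrm{rev}}$.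 For $s<t$, $\kappa_{st}$ is divisible by $x-1$; the reduced kernel has $\overline{\kappa}_{st}=\kappa_{st}/(x-1)$ for $s<t$ and $\overline{\kappa}_{ss}=-1$. The Chow function is $\mathrm{H}=-(\overline{\kappa})^{-1}$. The right KLS function is the unique $f\in\mathcal{I}_\rho(P)$ with $f_{ss}=1$, $\deg f_{st}<\rho_{st}/2$ for $s<t$, $f^{\mathrm{rev}}=\kappa f$; the left KLS function is the unique $g\in\mathcal{I}_\rho(P)$ with $g_{ss}=1$, $\deg g_{st}<\rho_{st}/2$ for $s<t$, $g^{\mathrm{rev}}=g\kappa$. *)

theory Defs
  imports "HOL-Computational_Algebra.Computational_Algebra"
begin

class locally_finite_order = order +
  assumes finite_interval: "finite {s..t}"

text \<open>
  A weak rank function is only meaningful on pairs \<open>s \<le> t\<close>; nothing is required of the values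
  at other pairs.
\<close>

definition weak_rank :: "('a::locally_finite_order \<Rightarrow> 'a \<Rightarrow> nat) \<Rightarrow> bool" where
  "weak_rank \<rho> \<longleftrightarrow>
     (\<forall>s t. s < t \<longrightarrow> \<rho> s t > 0) \<and>
     (\<forall>s w t. s \<le> w \<longrightarrow> w \<le> t \<longrightarrow> \<rho> s t = \<rho> s w + \<rho> w t)"

text \<open>
  A function on closed intervals is represented by a binary function that vanishes at pairs
  which are not of the form \<open>s \<le> t\<close>, so that equality of functions is equality on intervals.
\<close>

type_synonym 'a incidence = "'a \<Rightarrow> 'a \<Rightarrow> int poly"

definition incidence_algebra :: "'a::locally_finite_order incidence set" where
  "incidence_algebra = {a. \<forall>s t. \<not> s \<le> t \<longrightarrow> a s t = 0}"

definition inc_one :: "'a::locally_finite_order incidence" where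
  "inc_one s t = (if s = t then 1 else 0)"

definition inc_mult ::
    "'a::locally_finite_order incidence \<Rightarrow> 'a incidence \<Rightarrow> 'a incidence" where
  "inc_mult a b s t = (\<Sum>w\<in>{s..t}. a s w * b w t)"

definition is_inc_inverse ::
    "'a::locally_finite_order incidence \<Rightarrow> 'a incidence \<Rightarrow> bool" where
  "is_inc_inverse a b \<longleftrightarrow>
     b \<in> incidence_algebra \<and> inc_mult a b = inc_one \<and> inc_mult b a = inc_one"

text \<open>
  Only meaningful for invertible \<open>a\<close>; see \<open>is_inc_inverse_inc_inverse\<close> below.
\<close>

definition inc_inverse :: "'a::locally_finite_order incidence \<Rightarrow> 'a incidence" where
  "inc_inverse a = (THE b. is_inc_inverse a b)"

definition incidence_algebra_rank ::
    "('a::locally_finite_order \<Rightarrow> 'a \<Rightarrow> nat) \<Rightarrow> 'a incidence set" where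
  "incidence_algebra_rank \<rho> =
     {a \<in> incidence_algebra. \<forall>s t. s \<le> t \<longrightarrow> degree (a s t) \<le> \<rho> s t}"

text \<open>
  \<open>reflect_poly p\<close> is \<open>x ^ degree p * p (1 / x)\<close>, so for \<open>degree p \<le> n\<close> the polynomial
  \<open>rev_poly n p\<close> is \<open>x ^ n * p (1 / x)\<close>.
\<close>

definition rev_poly :: "nat \<Rightarrow> int poly \<Rightarrow> int poly" where
  "rev_poly n p = monom 1 (n - degree p) * reflect_poly p"

definition inc_rev ::
    "('a::locally_finite_order \<Rightarrow> 'a \<Rightarrow> nat) \<Rightarrow> 'a incidence \<Rightarrow> 'a incidence" where
  "inc_rev \<rho> a s t = rev_poly (\<rho> s t) (a s t)"

definition is_kernel ::
    "('a::locally_finite_order \<Rightarrow> 'a \<Rightarrow> nat) \<Rightarrow> 'a incidence \<Rightarrow> bool" where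
  "is_kernel \<rho> \<kappa> \<longleftrightarrow>
     \<kappa> \<in> incidence_algebra_rank \<rho> \<and> (\<forall>s. \<kappa> s s = 1) \<and> inc_inverse \<kappa> = inc_rev \<rho> \<kappa>"

text \<open>
  The polynomial \<open>x - 1\<close> is \<open>[:-1, 1:]\<close>; the division is exact by \<open>kernel_dvd\<close> below.
\<close>

definition reduced_kernel :: "'a::locally_finite_order incidence \<Rightarrow> 'a incidence" where
  "reduced_kernel \<kappa> s t =
     (if s = t then -1 else if s < t then \<kappa> s t div [:-1, 1:] else 0)"

definition chow_function :: "'a::locally_finite_order incidence \<Rightarrow> 'a incidence" where
  "chow_function \<kappa> s t = - inc_inverse (reduced_kernel \<kappa>) s t"

definition right_KLS ::
    "('a::locally_finite_order \<Rightarrow> 'a \<Rightarrow> nat) \<Rightarrow> 'a incidence \<Rightarrow> 'a incidence \<Rightarrow> bool" where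
  "right_KLS \<rho> \<kappa> f \<longleftrightarrow>
     f \<in> incidence_algebra_rank \<rho> \<and> (\<forall>s. f s s = 1) \<and>
     (\<forall>s t. s < t \<longrightarrow> real (degree (f s t)) < real (\<rho> s t) / 2) \<and>
     inc_rev \<rho> f = inc_mult \<kappa> f"

definition left_KLS ::
    "('a::locally_finite_order \<Rightarrow> 'a \<Rightarrow> nat) \<Rightarrow> 'a incidence \<Rightarrow> 'a incidence \<Rightarrow> bool" where
  "left_KLS \<rho> \<kappa> g \<longleftrightarrow>
     g \<in> incidence_algebra_rank \<rho> \<and> (\<forall>s. g s s = 1) \<and>
     (\<forall>s t. s < t \<longrightarrow> real (degree (g s t)) < real (\<rho> s t) / 2) \<and>
     inc_rev \<rho> g = inc_mult g \<kappa>"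


subsection \<open>Well-definedness\<close>

lemma coeff_rev_poly:
  assumes "degree p \<le> n"
  shows "coeff (rev_poly n p) k = (if k \<le> n then coeff p (n - k) else 0)"
  using assms by (auto simp: rev_poly_def coeff_monom_mult coeff_reflect_poly coeff_eq_0)

lemma inc_mult_closed: "inc_mult a b \<in> incidence_algebra"
  by (auto simp: incidence_algebra_def inc_mult_def)

lemma inc_mult_assoc: "inc_mult (inc_mult a b) c = inc_mult a (inc_mult b c)"
proof (intro ext)
  fix s t
  have "inc_mult (inc_mult a b) c s t
      = (\<Sum>w\<in>{s..t}. \<Sum>v | v \<in> {s..t} \<and> v \<le> w. a s v * b v w * c w t)"
    unfolding inc_mult_def sum_distrib_right
    by (intro sum.cong refl) auto
  also have "\<dots> = (\<Sum>v\<in>{s..t}. \<Sum>w | w \<in> {s..t} \<and> v \<le> w. a s v * b v w * c w t)"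
    by (intro sum.swap_restrict finite_interval)
  also have "\<dots> = inc_mult a (inc_mult b c) s t"
    unfolding inc_mult_def sum_distrib_left
    by (intro sum.cong refl) (auto simp: mult.assoc)
  finally show "inc_mult (inc_mult a b) c s t = inc_mult a (inc_mult b c) s t" .
qed

lemma inc_mult_one_right:
  assumes "a \<in> incidence_algebra"
  shows "inc_mult a inc_one = a"
proof (intro ext)
  fix s t
  show "inc_mult a inc_one s t = a s t"
  proof (cases "s \<le> t")
    case True
    have "inc_mult a inc_one s t = (\<Sum>w\<in>{s..t}. if w = t then a s w else 0)"
      unfolding inc_mult_def inc_one_def by (intro sum.cong) auto
    then show ?thesis using True by (simp add: finite_interval)
  qed (use assms in \<open>auto simp: incidence_algebra_def inc_mult_def\<close>)
qed

lemma inc_mult_one_left: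
  assumes "a \<in> incidence_algebra"
  shows "inc_mult inc_one a = a"
proof (intro ext)
  fix s t
  show "inc_mult inc_one a s t = a s t"
  proof (cases "s \<le> t")
    case True
    have "inc_mult inc_one a s t = (\<Sum>w\<in>{s..t}. if s = w then a w t else 0)"
      unfolding inc_mult_def inc_one_def by (intro sum.cong) auto
    then show ?thesis using True by (simp add: finite_interval)
  qed (use assms in \<open>auto simp: incidence_algebra_def inc_mult_def\<close>)
qed

lemma is_inc_inverse_unique:
  assumes "is_inc_inverse a b" "is_inc_inverse a c"
  shows "b = c"
proof -
  have "b = inc_mult b (inc_mult a c)"
    using assms inc_mult_one_right[of b] by (simp add: is_inc_inverse_def)
  also have "\<dots> = inc_mult (inc_mult b a) c" by (simp only: inc_mult_assoc)
  also have "\<dots> = c"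
    using assms inc_mult_one_left[of c] by (simp add: is_inc_inverse_def)
  finally show ?thesis .
qed

lemma card_interval_less:
  fixes s w t :: "'a::locally_finite_order"
  assumes "s \<le> w" "w < t"
  shows "card {s..w} < card {s..t}"
proof (rule psubset_card_mono[OF finite_interval])
  have "t \<in> {s..t}" "t \<notin> {s..w}" using assms by auto
  then show "{s..w} \<subset> {s..t}" using assms by auto
qed

function left_inv ::
    "'a::locally_finite_order incidence \<Rightarrow> ('a \<Rightarrow> int poly) \<Rightarrow> 'a incidence" where
  "left_inv a u s t =
     (if s \<le> t then (inc_one s t - (\<Sum>w\<in>{s..<t}. left_inv a u s w * a w t)) * u t else 0)"
  by pat_completeness auto
termination
  by (relation "Wellfounded.measure (\<lambda>(a, u, s, t). card {s..t})")
    (auto intro: card_interval_less)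

declare left_inv.simps [simp del]

lemma left_inverse_exists:
  fixes a :: "'a::locally_finite_order incidence"
  assumes "\<And>s. a s s dvd 1"
  obtains b where "b \<in> incidence_algebra" "inc_mult b a = inc_one" "\<And>s. b s s dvd 1"
proof -
  from assms have "\<forall>s. \<exists>u. 1 = a s s * u" by (auto simp: dvd_def)
  then obtain u where u: "\<And>s. 1 = a s s * u s" by metis
  have "inc_mult (left_inv a u) a s t = inc_one s t" for s t
  proof (cases "s \<le> t")
    case True
    then have "{s..t} = insert t {s..<t}" by auto
    moreover have "finite {s..<t}"
      by (rule finite_subset[OF _ finite_interval[of s t]]) auto
    ultimately have "inc_mult (left_inv a u) a s t
        = left_inv a u s t * a t t + (\<Sum>w\<in>{s..<t}. left_inv a u s w * a w t)"
      by (simp add: inc_mult_def)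
    moreover have "left_inv a u s t * a t t
        = inc_one s t - (\<Sum>w\<in>{s..<t}. left_inv a u s w * a w t)"
      using True u[of t] by (subst left_inv.simps) (simp add: mult.assoc mult.commute[of "u t"])
    ultimately show ?thesis by simp
  qed (auto simp: inc_mult_def inc_one_def)
  moreover have "left_inv a u \<in> incidence_algebra"
    unfolding incidence_algebra_def by (auto simp: left_inv.simps)
  moreover have "left_inv a u s s dvd 1" for s
    using dvd_triv_right[of "u s" "a s s"] u[of s] by (subst left_inv.simps) (simp add: inc_one_def)
  ultimately show thesis using that by blast
qed

lemma is_inc_inverse_inc_inverse:
  fixes a :: "'a::locally_finite_order incidence"
  assumes "a \<in> incidence_algebra" "\<And>s. a s s dvd 1"
  shows "is_inc_inverse a (inc_inverse a)"
proof -
  obtain b where b: "b \<in> incidence_algebra" "inc_mult b a = inc_one" "\<And>s. b s s dvd 1"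
    using left_inverse_exists assms(2) by metis
  obtain c where c: "c \<in> incidence_algebra" "inc_mult c b = inc_one"
    using left_inverse_exists b(3) by metis
  have "c = inc_mult c (inc_mult b a)" using b c by (simp add: inc_mult_one_right)
  also have "\<dots> = a" using c assms(1) by (simp add: inc_mult_one_left flip: inc_mult_assoc)
  finally have "is_inc_inverse a b" using b c by (simp add: is_inc_inverse_def)
  then show ?thesis
    unfolding inc_inverse_def by (metis the_equality is_inc_inverse_unique)
qed

lemma poly_Poly_1: "poly (Poly xs) (1 :: int) = sum_list xs"
  by (induction xs) auto

lemma poly_rev_poly_1: "poly (rev_poly n p) 1 = poly p 1"
  using poly_Poly_1[of "coeffs p"]
  by (simp add: rev_poly_def poly_monom reflect_poly_def poly_Poly_1)

lemma kernel_dvd: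
  assumes "is_kernel \<rho> \<kappa>" "s < t"
  shows "[:-1, 1:] dvd \<kappa> s t"
  using assms(2)
proof (induction "card {s..t}" arbitrary: s t rule: less_induct)
  case less
  have one: "\<kappa> r r = 1" for r using assms(1) by (simp add: is_kernel_def)
  have "is_inc_inverse \<kappa> (inc_rev \<rho> \<kappa>)"
    using is_inc_inverse_inc_inverse[of \<kappa>] assms(1)
    by (simp add: is_kernel_def incidence_algebra_rank_def)
  then have "inc_mult \<kappa> (inc_rev \<rho> \<kappa>) s t = 0"
    using less.prems by (simp add: is_inc_inverse_def inc_one_def)
  then have "poly (\<Sum>w\<in>{s..t}. \<kappa> s w * inc_rev \<rho> \<kappa> w t) 1 = 0"
    by (simp add: inc_mult_def)
  then have z: "(\<Sum>w\<in>{s..t}. poly (\<kappa> s w) 1 * poly (\<kappa> w t) 1) = 0"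
    by (simp add: poly_sum inc_rev_def poly_rev_poly_1)
  have "poly (\<kappa> s w) 1 = 0" if "w \<in> {s<..<t}" for w
    using less.hyps[of s w] card_interval_less[of s w t] that
    by (auto simp: poly_eq_0_iff_dvd)
  moreover have "{s..t} = insert s (insert t {s<..<t})" using less.prems by auto
  moreover have "finite {s<..<t}"
    by (rule finite_subset[OF _ finite_interval[of s t]]) auto
  ultimately have "2 * poly (\<kappa> s t) 1 = 0" using z less.prems by (simp add: one)
  then show ?case by (simp add: poly_eq_0_iff_dvd)
qed

end

(*
  The convention that kappabar is -1 on the diagonal makes kappa = (x - 1) kappabar + x 1 hold in
  the whole incidence algebra, so multiplying by H = - kappabar^{-1} gives
  H kappa = kappa H = x H - (x - 1) 1. Hence H f^rev = H kappa f = x H f - (x - 1) f, that is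
  H (f^rev - x f) = - (x - 1) f, and symmetrically (g^rev - x g) H = - (x - 1) g. The recursions
  are these identities at [s,t], since all diagonal values of H, f, g, f^rev, g^rev are 1.
*)
theory Submission
  imports Defs
begin

text \<open>In the convolutions below, \<open>H s t\<close> occurs only in an endpoint term;
  splitting off both endpoints isolates it.\<close>

lemma sum_interval_split:
  fixes s t :: "'a::locally_finite_order"
  assumes "s < t"
  shows "sum F {s..t} = F s + F t + sum F {s<..<t}"
proof -
  have "{s..t} = insert s (insert t {s<..<t})" using assms by auto
  moreover have "finite {s<..<t}"
    by (rule finite_subset[OF _ finite_interval[of s t]]) auto
  ultimately show ?thesis using assms by (simp add: add.assoc)
qed

lemma inc_mult_diag: "inc_mult a b s s = a s s * b s s"
  by (simp add: inc_mult_def)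

lemma inc_mult_smult_left: "inc_mult (\<lambda>s t. c * a s t) b s t = c * inc_mult a b s t"
  by (simp add: inc_mult_def sum_distrib_left mult_ac)

lemma inc_mult_smult_right: "inc_mult a (\<lambda>s t. c * b s t) s t = c * inc_mult a b s t"
  by (simp add: inc_mult_def sum_distrib_left mult_ac)

lemma inc_mult_diff_left:
  "inc_mult (\<lambda>s t. a s t - b s t) c s t = inc_mult a c s t - inc_mult b c s t"
  by (simp add: inc_mult_def sum_subtractf algebra_simps)

lemma inc_mult_diff_right:
  "inc_mult a (\<lambda>s t. b s t - c s t) s t = inc_mult a b s t - inc_mult a c s t"
  by (simp add: inc_mult_def sum_subtractf algebra_simps)

lemma inc_mult_add_left:
  "inc_mult (\<lambda>s t. a s t + b s t) c s t = inc_mult a c s t + inc_mult b c s t"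
  by (simp add: inc_mult_def sum.distrib algebra_simps)

lemma inc_mult_add_right:
  "inc_mult a (\<lambda>s t. b s t + c s t) s t = inc_mult a b s t + inc_mult a c s t"
  by (simp add: inc_mult_def sum.distrib algebra_simps)

lemma inc_mult_uminus_left: "inc_mult (\<lambda>s t. - a s t) b s t = - inc_mult a b s t"
  by (simp add: inc_mult_def sum_negf)

lemma inc_mult_uminus_right: "inc_mult a (\<lambda>s t. - b s t) s t = - inc_mult a b s t"
  by (simp add: inc_mult_def sum_negf)

text \<open>For s < t the division by x - 1 is exact by \<open>kernel_dvd\<close>; on the diagonal
  -(x - 1) + x = 1, which is where the value -1 of \<open>reduced_kernel\<close> is used.\<close>

lemma kernel_eq_reduced_kernel:
  fixes \<kappa> :: "'a::locally_finite_order incidence"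
  assumes "is_kernel \<rho> \<kappa>"
  shows "\<kappa> = (\<lambda>s t. [:-1, 1:] * reduced_kernel \<kappa> s t + [:0, 1:] * inc_one s t)"
proof (intro ext)
  fix s t :: 'a
  consider "s = t" | "s < t" | "\<not> s \<le> t" by (metis order.order_iff_strict)
  then show "\<kappa> s t = [:-1, 1:] * reduced_kernel \<kappa> s t + [:0, 1:] * inc_one s t"
  proof cases
    case 1
    have "[:-1, 1:] * (-1) + [:0, 1:] * 1 = (1 :: int poly)" by (simp add: one_pCons)
    with 1 assms show ?thesis by (simp add: reduced_kernel_def inc_one_def is_kernel_def)
  next
    case 2
    have "\<kappa> s t = [:-1, 1:] * (\<kappa> s t div [:-1, 1:])"
      using kernel_dvd[OF assms 2] by (simp only: dvd_mult_div_cancel)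
    with 2 show ?thesis by (auto simp: reduced_kernel_def inc_one_def)
  next
    case 3
    then have "\<kappa> s t = 0" "s \<noteq> t" "\<not> s < t"
      using assms by (auto simp: is_kernel_def incidence_algebra_rank_def incidence_algebra_def)
    then show ?thesis by (simp add: reduced_kernel_def inc_one_def)
  qed
qed

text \<open>The diagonal entries are -1, a unit of Z[x], which is enough for invertibility.\<close>

lemma is_inc_inverse_reduced_kernel:
  "is_inc_inverse (reduced_kernel \<kappa>) (inc_inverse (reduced_kernel \<kappa>))"
  by (rule is_inc_inverse_inc_inverse) (auto simp: incidence_algebra_def reduced_kernel_def)

lemma chow_function_closed: "chow_function \<kappa> \<in> incidence_algebra"
  using is_inc_inverse_reduced_kernel[of \<kappa>]
  by (simp add: is_inc_inverse_def incidence_algebra_def chow_function_def)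

lemma chow_function_diag: "chow_function \<kappa> s s = 1"
proof -
  have "inc_mult (reduced_kernel \<kappa>) (inc_inverse (reduced_kernel \<kappa>)) s s = 1"
    using is_inc_inverse_reduced_kernel[of \<kappa>] by (simp add: is_inc_inverse_def inc_one_def)
  then show ?thesis by (simp add: inc_mult_diag reduced_kernel_def chow_function_def)
qed

lemma chow_function_mult_reduced_kernel:
  "inc_mult (chow_function \<kappa>) (reduced_kernel \<kappa>) s t = - inc_one s t"
  using is_inc_inverse_reduced_kernel[of \<kappa>]
  by (simp add: is_inc_inverse_def chow_function_def[abs_def] inc_mult_uminus_left)

lemma reduced_kernel_mult_chow_function:
  "inc_mult (reduced_kernel \<kappa>) (chow_function \<kappa>) s t = - inc_one s t"
  using is_inc_inverse_reduced_kernel[of \<kappa>]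
  by (simp add: is_inc_inverse_def chow_function_def[abs_def] inc_mult_uminus_right)

text \<open>Multiply \<kappa> = (x - 1) kappabar + x 1 by H on the left and use H kappabar =
  -1.\<close>

lemma chow_function_mult_kernel:
  assumes "is_kernel \<rho> \<kappa>"
  shows "inc_mult (chow_function \<kappa>) \<kappa>
    = (\<lambda>s t. [:0, 1:] * chow_function \<kappa> s t - [:-1, 1:] * inc_one s t)"
proof (intro ext)
  fix s t
  \<comment> \<open>Only the right factor is expanded: \<open>\<kappa>\<close> also occurs inside
    \<open>chow_function \<kappa>\<close> and in the expansion itself, so unrestricted rewriting
    would not stop.\<close>
  have "inc_mult (chow_function \<kappa>) \<kappa> s t
    = inc_mult (chow_function \<kappa>)
        (\<lambda>s t. [:-1, 1:] * reduced_kernel \<kappa> s t + [:0, 1:] * inc_one s t) s t"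
    using kernel_eq_reduced_kernel[OF assms] by (rule arg_cong)
  then show "inc_mult (chow_function \<kappa>) \<kappa> s t
    = [:0, 1:] * chow_function \<kappa> s t - [:-1, 1:] * inc_one s t"
    by (simp only: inc_mult_add_right inc_mult_smult_right chow_function_mult_reduced_kernel
        inc_mult_one_right[OF chow_function_closed])
qed

lemma kernel_mult_chow_function:
  assumes "is_kernel \<rho> \<kappa>"
  shows "inc_mult \<kappa> (chow_function \<kappa>)
    = (\<lambda>s t. [:0, 1:] * chow_function \<kappa> s t - [:-1, 1:] * inc_one s t)"
proof (intro ext)
  fix s t
  have "inc_mult \<kappa> (chow_function \<kappa>) s t
    = inc_mult (\<lambda>s t. [:-1, 1:] * reduced_kernel \<kappa> s t + [:0, 1:] * inc_one s t)
        (chow_function \<kappa>) s t"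
    using kernel_eq_reduced_kernel[OF assms] by (rule arg_cong)
  then show "inc_mult \<kappa> (chow_function \<kappa>) s t
    = [:0, 1:] * chow_function \<kappa> s t - [:-1, 1:] * inc_one s t"
    by (simp only: inc_mult_add_left inc_mult_smult_left reduced_kernel_mult_chow_function
        inc_mult_one_left[OF chow_function_closed])
qed

text \<open>By associativity H f^rev = H (\<kappa> f) = (H \<kappa>) f = x H f - (x - 1) f; the term
  x H f then moves to the left.\<close>

lemma chow_function_mult_right_KLS:
  assumes "is_kernel \<rho> \<kappa>" "right_KLS \<rho> \<kappa> f"
  shows "inc_mult (chow_function \<kappa>) (\<lambda>s t. inc_rev \<rho> f s t - [:0, 1:] * f s t) s t
    = - [:-1, 1:] * f s t"
proof -
  have f: "f \<in> incidence_algebra" "inc_rev \<rho> f = inc_mult \<kappa> f"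
    using assms(2) by (simp_all add: right_KLS_def incidence_algebra_rank_def)
  have "inc_mult (chow_function \<kappa>) (inc_rev \<rho> f) s t
      = [:0, 1:] * inc_mult (chow_function \<kappa>) f s t - [:-1, 1:] * f s t"
    by (simp only: f(2) inc_mult_assoc[symmetric] chow_function_mult_kernel[OF assms(1)]
        inc_mult_diff_left inc_mult_smult_left inc_mult_one_left[OF f(1)])
  then show ?thesis
    by (simp only: inc_mult_diff_right inc_mult_smult_right)
qed

text \<open>Mirror image: g^rev H = (g \<kappa>) H = g (\<kappa> H), so the formula for \<kappa> H
  applies.\<close>

lemma left_KLS_mult_chow_function:
  assumes "is_kernel \<rho> \<kappa>" "left_KLS \<rho> \<kappa> g"
  shows "inc_mult (\<lambda>s t. inc_rev \<rho> g s t - [:0, 1:] * g s t) (chow_function \<kappa>) s t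
    = - [:-1, 1:] * g s t"
proof -
  have g: "g \<in> incidence_algebra" "inc_rev \<rho> g = inc_mult g \<kappa>"
    using assms(2) by (simp_all add: left_KLS_def incidence_algebra_rank_def)
  have "inc_mult (inc_rev \<rho> g) (chow_function \<kappa>) s t
      = [:0, 1:] * inc_mult g (chow_function \<kappa>) s t - [:-1, 1:] * g s t"
    by (simp only: g(2) inc_mult_assoc kernel_mult_chow_function[OF assms(1)]
        inc_mult_diff_right inc_mult_smult_right inc_mult_one_right[OF g(1)])
  then show ?thesis
    by (simp only: inc_mult_diff_left inc_mult_smult_left)
qed

text \<open>1 - x is the diagonal value of f^rev - x f and of g^rev - x g.\<close>

lemma one_minus_X_poly: "(1 :: int poly) - [:0, 1:] = - [:-1, 1:]"
  by (simp add: one_pCons)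

text \<open>The recursion is first proved with the denominator x - 1 cleared, so that it stays
  inside Z[x].\<close>

lemma chow_function_right_KLS_recursion:
  assumes "is_kernel \<rho> \<kappa>" "right_KLS \<rho> \<kappa> f" "s < t"
  shows "[:-1, 1:] * chow_function \<kappa> s t = inc_rev \<rho> f s t - f s t
    + (\<Sum>w\<in>{s<..<t}. chow_function \<kappa> s w * (inc_rev \<rho> f w t - [:0, 1:] * f w t))"
    (is "?X * ?h = _ + ?S")
proof -
  \<comment> \<open>The second value is read off f^rev = \<kappa> f on the diagonal, where \<kappa>
    and f are 1.\<close>
  have diag: "f t t = 1" "inc_rev \<rho> f t t = 1"
    using assms by (simp_all add: right_KLS_def is_kernel_def inc_mult_diag)
  \<comment> \<open>The three summands are the term w = s, where H is 1, the term w = t, where f^rev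
    - x f is 1 - x, and the open interval.\<close>
  have "(inc_rev \<rho> f s t - [:0, 1:] * f s t) + ?h * (- ?X) + ?S = - ?X * f s t"
    using chow_function_mult_right_KLS[OF assms(1,2), of s t]
    by (simp only: inc_mult_def sum_interval_split[OF assms(3)] chow_function_diag diag
        one_minus_X_poly mult_1_left mult_1_right)
  \<comment> \<open>Combining the right-hand side with the endpoint w = s turns x f into f, which is
    why the leading term has f and the sum has x f.\<close>
  moreover have "[:0, 1:] * f s t - ?X * f s t = f s t"
    by simp
  ultimately show ?thesis
    by (simp only: algebra_simps)
qed

lemma chow_function_left_KLS_recursion:
  assumes "is_kernel \<rho> \<kappa>" "left_KLS \<rho> \<kappa> g" "s < t"
  shows "[:-1, 1:] * chow_function \<kappa> s t = inc_rev \<rho> g s t - g s t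
    + (\<Sum>w\<in>{s<..<t}. (inc_rev \<rho> g s w - [:0, 1:] * g s w) * chow_function \<kappa> w t)"
    (is "?X * ?h = _ + ?S")
proof -
  have diag: "g s s = 1" "inc_rev \<rho> g s s = 1"
    using assms by (simp_all add: left_KLS_def is_kernel_def inc_mult_diag)
  \<comment> \<open>The endpoints swap roles: \<open>H s t\<close> now comes from w = s, and w = t
    contributes with H equal to 1.\<close>
  have "(- ?X) * ?h + (inc_rev \<rho> g s t - [:0, 1:] * g s t) + ?S = - ?X * g s t"
    using left_KLS_mult_chow_function[OF assms(1,2), of s t]
    by (simp only: inc_mult_def sum_interval_split[OF assms(3)] chow_function_diag diag
        one_minus_X_poly mult_1_right)
  moreover have "[:0, 1:] * g s t - ?X * g s t = g s t"
    by simp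
  ultimately show ?thesis
    by (simp only: algebra_simps)
qed

lemma to_fract_sum: "to_fract (sum F A) = (\<Sum>w\<in>A. to_fract (F w))"
  by (induction A rule: infinite_finite_induct) simp_all

text \<open>Transfers an identity with cleared denominator to the fraction field, where c can be
  divided out; in each product only the second factor receives the denominator.\<close>

lemma to_fract_eq_Fract_sum:
  assumes "c \<noteq> 0" "c * h = a + (\<Sum>w\<in>A. p w * q w)"
  shows "to_fract h = Fract a c + (\<Sum>w\<in>A. to_fract (p w) * Fract (q w) c)"
proof -
  have "to_fract c * to_fract h = to_fract a + (\<Sum>w\<in>A. to_fract (p w) * to_fract (q w))"
    using arg_cong[OF assms(2), of to_fract] by (simp add: to_fract_sum)
  then have "to_fract h = (to_fract a + (\<Sum>w\<in>A. to_fract (p w) * to_fract (q w))) / to_fract c"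
    using assms(1) by (simp add: field_simps)
  then show ?thesis
    by (simp add: Fract_conv_to_fract add_divide_distrib sum_divide_distrib)
qed

theorem theorem3p9:
  fixes \<rho> :: "'a::locally_finite_order \<Rightarrow> 'a \<Rightarrow> nat"
    and \<kappa> f g H :: "'a \<Rightarrow> 'a \<Rightarrow> int poly"
    and s t :: 'a
  assumes "weak_rank \<rho>"
    and "is_kernel \<rho> \<kappa>"
    and "right_KLS \<rho> \<kappa> f"
    and "left_KLS \<rho> \<kappa> g"
    and "H = chow_function \<kappa>"
    and "s < t"
  shows "to_fract (H s t) =
           Fract (inc_rev \<rho> f s t - f s t) [:-1, 1:] +
           (\<Sum>w\<in>{s<..<t}. to_fract (H s w) *
              Fract (inc_rev \<rho> f w t - [:0, 1:] * f w t) [:-1, 1:])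
       \<and> to_fract (H s t) =
           Fract (inc_rev \<rho> g s t - g s t) [:-1, 1:] +
           (\<Sum>w\<in>{s<..<t}. Fract (inc_rev \<rho> g s w - [:0, 1:] * g s w) [:-1, 1:] *
              to_fract (H w t))"
proof -
  have X: "[:-1, 1:] \<noteq> (0 :: int poly)" by simp
  \<comment> \<open>The factors are swapped so that the one to be divided by x - 1 comes second, as
    \<open>to_fract_eq_Fract_sum\<close> expects; the products in the goal are commuted to match at
    the end.\<close>
  have "[:-1, 1:] * H s t = inc_rev \<rho> g s t - g s t
      + (\<Sum>w\<in>{s<..<t}. H w t * (inc_rev \<rho> g s w - [:0, 1:] * g s w))"
    unfolding assms(5) mult.commute[of "chow_function \<kappa> _ t"]
    by (rule chow_function_left_KLS_recursion[OF assms(2,4,6)])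
  from to_fract_eq_Fract_sum[OF X this]
    to_fract_eq_Fract_sum[OF X chow_function_right_KLS_recursion[OF assms(2,3,6)]]
  show ?thesis
    unfolding assms(5) by (simp only: mult.commute[of "Fract _ _"])
qed

end
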